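(* Let $\lambda\in\mathbb{C}_p$ with $\lambda\ne0$ and $|\lambda|_p\le1$ ($p$ an odd prime). For every $n\ge0$ and every odd positive integer $d$, \[ Ch_{n,\lambda}(d)+Ch_{n,\lambda}=2\sum_{a=0}^{d-1}\sum_{m=0}^n(a)_{m,\lambda}\,S_1(n,m)\,(-1)^a. \]
   Context: $(x)_{0,\lambda}=1$, $(x)_{n,\lambda}=x(x-\lambda)\cdots(x-(n-1)\lambda)$ for $n\ge1$, and $(1+\lambda u)^{x/\lambda}=\sum_{m\ge0}(x)_{m,\lambda}u^m/m!$. $S_1(n,m)$ are the signed Stirling numbers of the first kind: $x(x-1)\cdots(x-n+1)=\sum_{m=0}^nS_1(n,m)x^m$. The degenerate Changhee polynomials of the second kind: $\frac{2}{1+(1+\lambda\log(1+t))^{1/\lambda}}(1+\lambda\log(1+t))^{x/\lambda}=\sum_{n\ge0}Ch_{n,\lambda}(x)\frac{t^n}{n!}$, with $Ch_{n,\lambda}=Ch_{n,\lambda}(0)$. *)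

theory Defs
  imports "HOL-Analysis.Analysis"
    "HOL-Computational_Algebra.Computational_Algebra"
begin

section \<open>The field of \<open>p\<close>-adic complex numbers\<close>

locale nonarchimedean_field =
  fixes vabs :: "'a::field_char_0 \<Rightarrow> real"
  assumes vabs_nonneg: "0 \<le> vabs x"
    and vabs_eq_0_iff: "vabs x = 0 \<longleftrightarrow> x = 0"
    and vabs_mult: "vabs (x * y) = vabs x * vabs y"
    and vabs_ultra: "vabs (x + y) \<le> max (vabs x) (vabs y)"
begin

lemma vabs_minus: "vabs (- x) = vabs x"
proof -
  have "vabs (- x) * vabs (- x) = vabs x * vabs x"
    by (simp flip: vabs_mult)
  then show ?thesis
    using vabs_nonneg[of x] vabs_nonneg[of "- x"]
    by (metis abs_of_nonneg abs_mult_self_eq real_sqrt_mult_self real_sqrt_abs2)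
qed

sublocale metric: Metric_space UNIV "\<lambda>x y. vabs (x - y)"
proof
  fix x y z :: 'a
  show "0 \<le> vabs (x - y)" by (rule vabs_nonneg)
  show "vabs (x - y) = vabs (y - x)"
    using vabs_minus[of "x - y"] by simp
  show "vabs (x - y) = 0 \<longleftrightarrow> x = y" by (simp add: vabs_eq_0_iff)
  have "vabs (x - z) \<le> max (vabs (x - y)) (vabs (y - z))"
    using vabs_ultra[of "x - y" "y - z"] by simp
  then show "vabs (x - z) \<le> vabs (x - y) + vabs (y - z)"
    using vabs_nonneg[of "x - y"] vabs_nonneg[of "y - z"] by linarith
qed

text \<open>If \<open>vabs\<close> is complete and restricts to the \<open>p\<close>-adic absolute value on the rationals, then
  the closure of the rationals is their \<open>p\<close>-adic completion \<open>Q\<^sub>p\<close>.\<close>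

definition Q_closure :: "'a set" where
  "Q_closure = metric.mtopology closure_of \<rat>"

definition Q_closure_algebraic :: "'a set" where
  "Q_closure_algebraic =
     {x. \<exists>f. f \<noteq> 0 \<and> (\<forall>i. coeff f i \<in> Q_closure) \<and> poly f x = 0}"

end

text \<open>
  \<open>C\<^sub>p\<close> is the completion of an algebraic closure of \<open>Q\<^sub>p\<close>. The library has no such type, so the
  following locale says that the type \<open>'a\<close> with the absolute value \<open>vabs\<close> is this field: \<open>'a\<close> is
  complete, and the elements algebraic over \<open>Q\<^sub>p\<close> form an algebraically closed (hence an algebraic
  closure of \<open>Q\<^sub>p\<close>) and dense subset. This determines \<open>('a, vabs)\<close> up to isometric isomorphism.
  Multiplicativity, the ultrametric inequality and \<open>|p| = 1/p\<close> force \<open>vabs\<close> to be the normalised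
  \<open>p\<close>-adic absolute value on the rationals.
\<close>

locale padic_complex = nonarchimedean_field vabs
  for p :: nat and vabs :: "'a::field_char_0 \<Rightarrow> real" +
  assumes prime_p: "prime p"
    and vabs_p: "vabs (of_nat p) = 1 / real p"
    and mcomplete: "metric.mcomplete"
    and algebraically_closed:
      "\<lbrakk>degree f > 0; \<And>i. coeff f i \<in> Q_closure_algebraic\<rbrakk>
        \<Longrightarrow> \<exists>x\<in>Q_closure_algebraic. poly f x = 0"
    and algebraic_dense: "metric.mtopology closure_of Q_closure_algebraic = UNIV"


section \<open>Degenerate falling factorials and Stirling numbers\<close>

definition degen_ffact :: "'a::field_char_0 \<Rightarrow> 'a \<Rightarrow> nat \<Rightarrow> 'a" where
  "degen_ffact lam x n = (\<Prod>i<n. x - of_nat i * lam)"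

text \<open>Signed Stirling numbers of the first kind: the coefficients of \<open>x (x - 1) \<dots> (x - n + 1)\<close>.\<close>

definition S1 :: "nat \<Rightarrow> nat \<Rightarrow> int" where
  "S1 n m = coeff (\<Prod>i<n. [:- int i, 1:]) m"


section \<open>Degenerate Changhee polynomials of the second kind\<close>

text \<open>The formal power series \<open>(1 + \<lambda>u)\<^bsup>x/\<lambda>\<^esup>\<close> in \<open>u\<close>.\<close>

definition degen_exp :: "'a::field_char_0 \<Rightarrow> 'a \<Rightarrow> 'a fps" where
  "degen_exp lam x = Abs_fps (\<lambda>m. degen_ffact lam x m / fact m)"

text \<open>\<open>fps_ln 1\<close> is the series \<open>log (1 + t)\<close>, so \<open>degen_exp lam x oo fps_ln 1\<close> is
  \<open>(1 + \<lambda> log (1 + t))\<^bsup>x/\<lambda>\<^esup>\<close>. The denominator has constant coefficient \<open>2 \<noteq> 0\<close>.\<close>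

definition changhee_gf :: "'a::field_char_0 \<Rightarrow> 'a \<Rightarrow> 'a fps" where
  "changhee_gf lam x =
     2 / (1 + (degen_exp lam 1 oo fps_ln 1)) * (degen_exp lam x oo fps_ln 1)"

definition Ch :: "nat \<Rightarrow> 'a::field_char_0 \<Rightarrow> 'a \<Rightarrow> 'a" where
  "Ch n lam x = fact n * fps_nth (changhee_gf lam x) n"

lemma Ch_generating_function:
  "changhee_gf lam x = Abs_fps (\<lambda>n. Ch n lam x / fact n)"
  by (simp add: fps_eq_iff Ch_def)

end

theory Submission
  imports Defs
begin

text \<open>Put \<open>E = (1 + \<lambda> log (1 + t))\<^bsup>1/\<lambda>\<^esup>\<close>. The exponent law gives
  \<open>(1 + \<lambda> log (1 + t))\<^bsup>a/\<lambda>\<^esup> = E ^ a\<close>, so for odd \<open>d\<close> the left-hand side has generating function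
  \<open>2 (1 + E ^ d) / (1 + E) = 2 (\<Sum>a<d. (- E) ^ a)\<close>. The coefficients of \<open>E ^ a\<close> follow from those of
  \<open>log (1 + t) ^ m\<close>, which are the Stirling numbers \<open>S1\<close> up to factorials.\<close>

lemma S1_0: "S1 0 m = (if m = 0 then 1 else 0)"
  by (simp add: S1_def)

lemma S1_Suc: "S1 (Suc n) m = (if m = 0 then 0 else S1 n (m - 1)) - int n * S1 n m"
  by (cases m) (simp_all add: S1_def mult.commute[of "prod _ _"])

text \<open>The factor \<open>1 + fps_X\<close> clears the denominator of the derivative of log (1 +
  t), so comparing coefficients gives a two-term recurrence.\<close>

lemma fps_ln_power_deriv:
  "(1 + fps_X) * fps_deriv (fps_ln 1 ^ m :: 'a::field_char_0 fps) = of_nat m * fps_ln 1 ^ (m - 1)"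
proof -
  have "(1 + fps_X) * inverse (1 + fps_X :: 'a fps) = 1"
    by (rule inverse_mult_eq_1') simp
  then show ?thesis
    by (simp add: fps_deriv_power fps_ln_deriv fps_of_nat mult_ac)
qed

text \<open>Both sides satisfy the recurrence \<open>S1_Suc\<close> up to factorials. It links
  \<open>m\<close> to \<open>m - 1\<close>, so \<open>m\<close> stays arbitrary in the
  induction.\<close>

lemma fps_nth_ln_power:
  "fact n * fps_nth (fps_ln 1 ^ m :: 'a::field_char_0 fps) n = fact m * of_int (S1 n m)"
proof (induction n arbitrary: m)
  case 0
  show ?case by (cases m) (simp_all add: S1_0)
next
  case (Suc n)
  have rec: "of_nat (Suc n) * fps_nth (fps_ln 1 ^ m) (Suc n) + of_nat n * fps_nth (fps_ln 1 ^ m) n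
      = (of_nat m * fps_nth (fps_ln 1 ^ (m - 1)) n :: 'a)"
    using arg_cong[OF fps_ln_power_deriv[of m, where 'a = 'a], of "\<lambda>f. fps_nth f n"]
    by (cases n) (simp_all add: distrib_right flip: fps_of_nat)
  have "fact (Suc n) * fps_nth (fps_ln 1 ^ m) (Suc n)
      = (of_nat m * (fact n * fps_nth (fps_ln 1 ^ (m - 1)) n)
        - of_nat n * (fact n * fps_nth (fps_ln 1 ^ m) n) :: 'a)"
    using arg_cong[OF rec, of "\<lambda>x. fact n * x"] by (simp add: algebra_simps)
  also have "\<dots> = fact m * of_int (S1 (Suc n) m)"
    unfolding Suc.IH by (cases m) (simp_all add: S1_Suc algebra_simps)
  finally show ?case .
qed

text \<open>Pulling \<open>lam\<close> out of each factor leaves a falling factorial of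
  \<open>x / lam\<close>; this makes the addition law of binomial series available.\<close>

lemma degen_exp_conv_binomial:
  assumes "lam \<noteq> 0"
  shows "degen_exp lam x = fps_binomial (x / lam) oo (fps_const lam * fps_X)"
proof (rule fps_ext)
  fix n
  have "degen_ffact lam x n = lam ^ n * (\<Prod>i<n. x / lam - of_nat i)"
    using assms by (induction n) (simp_all add: degen_ffact_def field_simps)
  then show "fps_nth (degen_exp lam x) n
      = fps_nth (fps_binomial (x / lam) oo (fps_const lam * fps_X)) n"
    by (simp add: degen_exp_def fps_compose_linear gbinomial_prod_rev atLeast0LessThan)
qed

lemma degen_exp_power:
  assumes "lam \<noteq> 0"
  shows "degen_exp lam (of_nat a) = degen_exp lam 1 ^ a"
proof (induction a)
  case 0
  show ?case
    by (simp add: degen_exp_conv_binomial[OF assms])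
next
  case (Suc a)
  have "degen_exp lam (of_nat (Suc a)) = degen_exp lam 1 * degen_exp lam (of_nat a)"
    by (simp add: degen_exp_conv_binomial[OF assms] add_divide_distrib fps_binomial_add_mult
        fps_compose_mult_distrib)
  with Suc show ?case by simp
qed

text \<open>The \<open>fact m\<close> from the power of the logarithm cancels the denominator in
  \<open>degen_exp\<close>.\<close>

lemma fps_nth_degen_exp_ln:
  "fact n * fps_nth (degen_exp lam x oo fps_ln 1) n
    = (\<Sum>m\<in>{0..n}. degen_ffact lam x m * of_int (S1 n m))"
  unfolding fps_compose_nth sum_distrib_left
proof (rule sum.cong)
  fix m
  show "fact n * (fps_nth (degen_exp lam x) m * fps_nth (fps_ln 1 ^ m) n)
      = degen_ffact lam x m * of_int (S1 n m)"
    using fps_nth_ln_power[of n m, where 'a = 'a] by (simp add: degen_exp_def field_simps)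
qed simp

text \<open>Geometric sum with ratio \<open>- x\<close>; oddness of \<open>d\<close> turns 1 -
  (-x)^d into 1 + x^d.\<close>

lemma alternating_geometric_sum:
  fixes x :: "'a::comm_ring_1"
  assumes "odd d"
  shows "(1 + x) * (\<Sum>a\<in>{0..<d}. (- x) ^ a) = 1 + x ^ d"
  using one_diff_power_eq[of "- x" d] assms by (simp add: atLeast0LessThan)

theorem theorem2p8:
  fixes p :: nat and vabs :: "'a::field_char_0 \<Rightarrow> real" and lam :: 'a and n d :: nat
  assumes "padic_complex p vabs"
    and "odd p"
    and "lam \<noteq> 0"
    and "vabs lam \<le> 1"
    and "odd d"
  shows "Ch n lam (of_nat d) + Ch n lam 0 =
    2 * (\<Sum>a\<in>{0..<d}. \<Sum>m\<in>{0..n}.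
      degen_ffact lam (of_nat a) m * of_int (S1 n m) * (-1) ^ a)"
proof -
  define E :: "'a fps" where "E = degen_exp lam 1 oo fps_ln 1"
  have E_power: "degen_exp lam (of_nat a) oo fps_ln 1 = E ^ a" for a
    by (simp add: E_def degen_exp_power[OF \<open>lam \<noteq> 0\<close>] fps_compose_power)
  have "fps_nth E 0 = 1"
    by (simp add: E_def degen_exp_def degen_ffact_def)
  \<comment> \<open>The constant coefficient is 2, nonzero in characteristic 0, so division by
    \<open>1 + E\<close> is multiplication by its inverse.\<close>
  then have unit: "fps_nth (1 + E) 0 \<noteq> 0"
    by simp
  have "changhee_gf lam (of_nat d) + changhee_gf lam 0 = 2 * inverse (1 + E) * (1 + E ^ d)"
    using E_power[of d] E_power[of 0] unit
    by (simp add: changhee_gf_def fps_divide_unit algebra_simps flip: E_def)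
  also have "\<dots> = 2 * (inverse (1 + E) * (1 + E)) * (\<Sum>a\<in>{0..<d}. (- E) ^ a)"
    by (simp only: mult.assoc flip: alternating_geometric_sum[OF \<open>odd d\<close>])
  also have "\<dots> = 2 * (\<Sum>a\<in>{0..<d}. (- E) ^ a)"
    using inverse_mult_eq_1[OF unit] by simp
  \<comment> \<open>Writing the signs as constant series lets the coefficient of t^n be read off
    termwise.\<close>
  also have "\<dots> = fps_const 2 * (\<Sum>a\<in>{0..<d}. fps_const ((- 1) ^ a) * E ^ a)"
    by (simp add: power_minus[of E] flip: fps_const_power fps_const_neg numeral_fps_const)
  finally have gf: "changhee_gf lam (of_nat d) + changhee_gf lam 0
      = fps_const 2 * (\<Sum>a\<in>{0..<d}. fps_const ((- 1) ^ a) * E ^ a)" .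
  have "Ch n lam (of_nat d) + Ch n lam 0
      = fact n * fps_nth (changhee_gf lam (of_nat d) + changhee_gf lam 0) n"
    by (simp add: Ch_def distrib_left)
  also have "\<dots> = 2 * (\<Sum>a\<in>{0..<d}. (fact n * fps_nth (E ^ a) n) * (- 1) ^ a)"
    by (simp add: gf fps_sum_nth sum_distrib_left mult_ac)
  also have "\<dots> = 2 * (\<Sum>a\<in>{0..<d}. \<Sum>m\<in>{0..n}.
      degen_ffact lam (of_nat a) m * of_int (S1 n m) * (-1) ^ a)"
    by (simp only: fps_nth_degen_exp_ln sum_distrib_right flip: E_power)
  finally show ?thesis .
qed

end
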